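(* Let $d$ be a positive integer. Let $\Lambda$ be the tail-dependence matrix of the $d$-dimensional random vector $$\mathbf{Y}=\mathbf{X}\,pU+(\mathbf{1}-\mathbf{X})\bigl(p+(1-p)V\bigr),$$ where $\mathbf{1}=(1,\ldots,1)$, $U,V\sim\mathrm{U}[0,1]$, $\mathbf{X}=(X_1,\ldots,X_d)$ is a random vector with values in $\{0,1\}^d$ and $\mathbb{E}[X_1]=\cdots=\mathbb{E}[X_d]=p\in(0,1]$, and $U,V,\mathbf{X}$ are independent. (i) For $\alpha\in[0,1]$, if $\mathbf{X}$ has independent components and $\mathbb{E}[X_1]=\cdots=\mathbb{E}[X_d]=\alpha$, then $\Lambda$ is an equicorrelation matrix with parameter $\alpha$; that is, the equicorrelation matrix (a) is a tail-dependence matrix. (ii) For $\alpha\in[0,1]$, if $X_i=\prod_{j=i}^{i+d-1}Z_j$, $i=1,\ldots,d$, for independent Bernoulli $\mathrm{B}(1,\alpha)$ random variables $Z_1,\ldots,Z_{2d-1}$, then $\Lambda$ is an AR(1) matrix with parameter $\alpha$; that is, the AR(1) matrix (b) is a tail-dependence matrix. (iii) For $\alpha\in[0,1/2]$, if $X_i=\mathrm{I}_{\{Z\in[(i-1)(1-\alpha),\,(i-1)(1-\alpha)+1]\}}$, $i=1,\ldots,d$, for $Z\sim\mathrm{U}[0,d]$, then $\Lambda$ is an MA(1) matrix with parameter $\alpha$; that is, the MA(1) matrix (c) is a tail-dependence matrix.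
   Context: All random variables live on an atomless probability space; $\mathrm{I}_E$ is the indicator of $E$. The following $d\times d$ matrices $(\lambda_{ij})_{d\times d}$ are considered: (a) Equicorrelation matrix with parameter $\alpha\in[0,1]$: $\lambda_{ij}=\mathrm{I}_{\{i=j\}}+\alpha\,\mathrm{I}_{\{i\ne j\}}$, $i,j=1,\ldots,d$. (b) AR(1) matrix with parameter $\alpha\in[0,1]$: $\lambda_{ij}=\alpha^{|i-j|}$, $i,j=1,\ldots,d$. (c) MA(1) matrix with parameter $\alpha\in[0,1/2]$: $\lambda_{ij}=\mathrm{I}_{\{i=j\}}+\alpha\,\mathrm{I}_{\{|i-j|=1\}}$, $i,j=1,\ldots,d$. The (lower) tail-dependence coefficient of two random variables $X_1\sim F_1$, $X_2\sim F_2$ with continuous distribution functions is $\lambda=\lim_{u\downarrow 0}\frac{1}{u}\mathbb{P}(F_1(X_1)\le u,\ F_2(X_2)\le u)$, given that the limit exists. The tail-dependence matrix of a $d$-dimensional random vector with continuous marginal distributions is $(\lambda_{ij})_{d\times d}$, where $\lambda_{ij}$ is the tail-dependence coefficient of its $i$th and $j$th components. A matrix is called a tail-dependence matrix if it is the tail-dependence matrix of some such random vector. *)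

theory Defs
  imports "HOL-Probability.Probability"
begin

text \<open>
  A random vector with components \<open>1, \<dots>, d\<close> on \<open>M\<close> is a family \<open>X :: nat \<Rightarrow> 'a \<Rightarrow> real\<close>, and a
  \<open>d \<times> d\<close> matrix is a function \<open>nat \<Rightarrow> nat \<Rightarrow> real\<close>; only indices in \<open>{1..d}\<close> are ever relevant.
\<close>

definition atomless :: "'a measure \<Rightarrow> bool" where
  "atomless M \<longleftrightarrow>
    (\<forall>A\<in>sets M. 0 < measure M A \<longrightarrow>
      (\<exists>B\<in>sets M. B \<subseteq> A \<and> 0 < measure M B \<and> measure M B < measure M A))"

definition dist_fun :: "'a measure \<Rightarrow> ('a \<Rightarrow> real) \<Rightarrow> real \<Rightarrow> real" where
  "dist_fun M X = cdf (distr M borel X)"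

definition has_tail_dependence_coeff ::
    "'a measure \<Rightarrow> ('a \<Rightarrow> real) \<Rightarrow> ('a \<Rightarrow> real) \<Rightarrow> real \<Rightarrow> bool" where
  "has_tail_dependence_coeff M X1 X2 l \<longleftrightarrow>
    ((\<lambda>u. 1 / u *
        measure M {\<omega>\<in>space M. dist_fun M X1 (X1 \<omega>) \<le> u \<and> dist_fun M X2 (X2 \<omega>) \<le> u})
      \<longlongrightarrow> l) (at_right 0)"

definition has_tail_dependence_matrix ::
    "'a measure \<Rightarrow> nat \<Rightarrow> (nat \<Rightarrow> 'a \<Rightarrow> real) \<Rightarrow> (nat \<Rightarrow> nat \<Rightarrow> real) \<Rightarrow> bool" where
  "has_tail_dependence_matrix M d Y L \<longleftrightarrow>
    (\<forall>i\<in>{1..d}. Y i \<in> borel_measurable M \<and> continuous_on UNIV (dist_fun M (Y i))) \<and>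
    (\<forall>i\<in>{1..d}. \<forall>j\<in>{1..d}. has_tail_dependence_coeff M (Y i) (Y j) (L i j))"

definition is_tail_dependence_matrix :: "'a measure \<Rightarrow> nat \<Rightarrow> (nat \<Rightarrow> nat \<Rightarrow> real) \<Rightarrow> bool" where
  "is_tail_dependence_matrix M d L \<longleftrightarrow> (\<exists>Y. has_tail_dependence_matrix M d Y L)"

definition equicorrelation_matrix :: "real \<Rightarrow> nat \<Rightarrow> nat \<Rightarrow> real" where
  "equicorrelation_matrix \<alpha> i j = of_bool (i = j) + \<alpha> * of_bool (i \<noteq> j)"

text \<open>For \<open>\<alpha> = 0\<close> the convention \<open>0 ^ 0 = 1\<close> makes this the identity matrix.\<close>

definition ar1_matrix :: "real \<Rightarrow> nat \<Rightarrow> nat \<Rightarrow> real" where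
  "ar1_matrix \<alpha> i j = \<alpha> ^ nat \<bar>int i - int j\<bar>"

definition ma1_matrix :: "real \<Rightarrow> nat \<Rightarrow> nat \<Rightarrow> real" where
  "ma1_matrix \<alpha> i j = of_bool (i = j) + \<alpha> * of_bool (\<bar>int i - int j\<bar> = 1)"

definition uniform_rv :: "'a measure \<Rightarrow> ('a \<Rightarrow> real) \<Rightarrow> real \<Rightarrow> real \<Rightarrow> bool" where
  "uniform_rv M U a b \<longleftrightarrow>
    U \<in> borel_measurable M \<and> distr M borel U = uniform_measure lborel {a..b}"

definition bernoulli_rv :: "'a measure \<Rightarrow> ('a \<Rightarrow> real) \<Rightarrow> real \<Rightarrow> bool" where
  "bernoulli_rv M Z \<alpha> \<longleftrightarrow>
    Z \<in> borel_measurable M \<and>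
    distr M borel Z = distr (measure_pmf (bernoulli_pmf \<alpha>)) borel of_bool"

text \<open>
  Mutual independence of \<open>U\<close>, \<open>V\<close> and the vector \<open>X\<close>, stated through the generated
  sigma-algebras because \<open>indep_vars\<close> needs all variables to have the same range type.
  Nothing is said here about dependence among the components of \<open>X\<close>.
\<close>

definition indep_triple ::
    "'a measure \<Rightarrow> nat \<Rightarrow> ('a \<Rightarrow> real) \<Rightarrow> ('a \<Rightarrow> real) \<Rightarrow> (nat \<Rightarrow> 'a \<Rightarrow> real) \<Rightarrow> bool" where
  "indep_triple M d U V X \<longleftrightarrow>
    prob_space.indep_sets M
      (\<lambda>k. [sets (vimage_algebra (space M) U borel),
            sets (vimage_algebra (space M) V borel),
            sets (vimage_algebra (space M) (\<lambda>\<omega>. \<lambda>i\<in>{1..d}. X i \<omega>)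
              (Pi\<^sub>M {1..d} (\<lambda>_. borel)))] ! k)
      {..<3}"

definition mixture_setting ::
    "'a measure \<Rightarrow> nat \<Rightarrow> real \<Rightarrow> ('a \<Rightarrow> real) \<Rightarrow> ('a \<Rightarrow> real) \<Rightarrow> (nat \<Rightarrow> 'a \<Rightarrow> real) \<Rightarrow> bool" where
  "mixture_setting M d p U V X \<longleftrightarrow>
    0 < p \<and> p \<le> 1 \<and>
    uniform_rv M U 0 1 \<and> uniform_rv M V 0 1 \<and>
    (\<forall>i\<in>{1..d}. X i \<in> borel_measurable M \<and> (AE \<omega> in M. X i \<omega> \<in> {0, 1}) \<and>
      integral\<^sup>L M (X i) = p) \<and>
    indep_triple M d U V X"

definition mixture_vector ::
    "real \<Rightarrow> ('a \<Rightarrow> real) \<Rightarrow> ('a \<Rightarrow> real) \<Rightarrow> (nat \<Rightarrow> 'a \<Rightarrow> real) \<Rightarrow> nat \<Rightarrow> 'a \<Rightarrow> real" where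
  "mixture_vector p U V X i \<omega> = X i \<omega> * (p * U \<omega>) + (1 - X i \<omega>) * (p + (1 - p) * V \<omega>)"

end

theory Submission
  imports Defs
begin

text \<open>
  For \<open>u < p\<close> the event \<open>Y i \<le> u, Y j \<le> u\<close> is, up to a null set, \<open>X i = X j = 1, p U \<le> u\<close>, of
  probability \<open>(u / p) E[X i X j]\<close>; since every \<open>Y i\<close> is uniform on \<open>[0, 1]\<close>, the tail-dependence
  coefficients are \<open>E[X i X j] / p\<close>. Only the independence of \<open>U\<close> and \<open>X\<close> and of \<open>V\<close> and \<open>X\<close>
  enters, so \<open>V = U\<close> is allowed. Hence, to realise the three matrices on a given atomless space, it
  suffices to find a random subset \<open>K\<close> of \<open>{1..d}\<close> with a prescribed law together with one uniform
  variable independent of it. Both come from a single uniform variable \<open>W\<close>: cut \<open>[0, 1]\<close> into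
  intervals whose lengths are the probabilities of the values of \<open>K\<close>, and let \<open>U\<close> be the relative
  position of \<open>W\<close> in its interval. The variable \<open>W\<close> itself is read off a maximal chain of events,
  which by atomlessness contains an event of every probability. For \<open>\<alpha> = 0\<close> the first two
  constructions would need \<open>p = 0\<close>; there the matrix is the identity, which is the MA(1) matrix
  with \<open>\<alpha> = 0\<close>.
\<close>


section \<open>Atomless spaces carry a uniform variable\<close>

text \<open>The distribution function of the uniform distribution on \<open>[0, 1]\<close>. The
  clamped form is visibly continuous and covers all real arguments.\<close>

definition unit_cdf :: "real \<Rightarrow> real" where
  "unit_cdf x = max 0 (min 1 x)"

text \<open>
  Demanding that distinct members have distinct measures rules out members that differ by a null
  set; inserting an event into a gap of a maximal chain then only requires a comparison of measures.
\<close>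

definition measure_chain :: "'a measure \<Rightarrow> 'a set set \<Rightarrow> bool" where
  "measure_chain M C \<longleftrightarrow> C \<subseteq> sets M \<and>
    (\<forall>A\<in>C. \<forall>B\<in>C. A = B \<or> A \<subseteq> B \<and> measure M A < measure M B
      \<or> B \<subseteq> A \<and> measure M B < measure M A)"

lemma measure_chain_subset:
  "measure_chain M C \<Longrightarrow> A \<in> C \<Longrightarrow> B \<in> C \<Longrightarrow> measure M A \<le> measure M B \<Longrightarrow> A \<subseteq> B"
  unfolding measure_chain_def by (metis not_less order_refl)

text \<open>The chain may be uncountable, so measurability of its union is the issue. For a nonempty
  chain, either a member attains the supremum of the measures and is itself the union, or a sequence
  of members with measures tending to the supremum already exhausts the union.\<close>

lemma (in prob_space) measure_chain_Union:
  assumes C: "measure_chain M C" and le: "\<And>A. A \<in> C \<Longrightarrow> prob A \<le> t" and "0 \<le> t"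
  shows "\<Union>C \<in> sets M \<and> prob (\<Union>C) \<le> t"
proof (cases "C = {}")
  case True
  then show ?thesis using \<open>0 \<le> t\<close> by simp
next
  case False
  define s where "s = (SUP A\<in>C. prob A)"
  have bdd: "bdd_above (prob ` C)" using le by (auto intro: bdd_aboveI)
  have le_s: "prob A \<le> s" if "A \<in> C" for A
    unfolding s_def using that bdd by (rule cSUP_upper)
  show ?thesis
  proof (cases "\<exists>D\<in>C. prob D = s")
    case True
    then obtain D where D: "D \<in> C" "prob D = s" by blast
    then have "\<Union>C = D" using measure_chain_subset[OF C _ D(1)] le_s by blast
    then show ?thesis using D le C by (auto simp: measure_chain_def)
  next
    case False
    have "\<exists>A\<in>C. s - 1 / Suc n < prob A" for n
      using less_cSUP_iff[OF \<open>C \<noteq> {}\<close> bdd, of "s - 1 / Suc n"] by (simp add: s_def[symmetric])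
    then obtain A where A: "\<And>n. A n \<in> C" "\<And>n. s - 1 / Suc n < prob (A n)" by metis
    \<comment> \<open>The \<open>A n\<close> need not increase. The union of two members of a chain
      is the larger one, so the partial unions stay in \<open>C\<close> and continuity from below
      applies.\<close>
    define B where "B n = (\<Union>k\<le>n. A k)" for n
    have B: "B n \<in> C" for n
    proof (induction n)
      case (Suc n)
      have "B (Suc n) = B n \<union> A (Suc n)" by (auto simp: B_def le_Suc_eq)
      moreover have "B n \<subseteq> A (Suc n) \<or> A (Suc n) \<subseteq> B n"
        using measure_chain_subset[OF C] Suc A(1) by (meson linear)
      ultimately show ?case using Suc A(1) by (metis sup.absorb1 sup.absorb2)
    qed (simp add: B_def A)
    have UB: "(\<Union>n. B n) = (\<Union>n. A n)" by (auto simp: B_def)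
    have "\<Union>C = (\<Union>n. A n)"
    proof
      show "\<Union>C \<subseteq> (\<Union>n. A n)"
      proof
        fix x assume "x \<in> \<Union>C"
        then obtain D where D: "D \<in> C" "x \<in> D" by blast
        \<comment> \<open>No member attains \<open>s\<close>, so \<open>D\<close> stays a positive
          distance below it; some \<open>A n\<close> then has at least the measure of
          \<open>D\<close> and hence contains it.\<close>
        with False le_s have "0 < s - prob D" by force
        then obtain n where "1 / Suc n < s - prob D"
          using nat_approx_posE by metis
        then have "prob D \<le> prob (A n)" using A(2)[of n] by linarith
        then show "x \<in> (\<Union>n. A n)" using measure_chain_subset[OF C D(1) A(1)] D(2) by blast
      qed
    qed (use A in blast)
    moreover have "range B \<subseteq> events" using B C by (auto simp: measure_chain_def)
    moreover have "incseq B" by (fastforce simp: incseq_def B_def)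
    ultimately show ?thesis
      using finite_Lim_measure_incseq[of B] le[OF B] sets.countable_UN[where A = B and M = M and X = UNIV]
      unfolding UB by (auto intro!: LIMSEQ_le_const2)
  qed
qed

text \<open>Turns intersections into unions, so that \<open>measure_chain_Union\<close> also
  controls the intersection of the members above a level.\<close>

lemma (in prob_space) measure_chain_complement:
  assumes "measure_chain M C"
  shows "measure_chain M ((-) (space M) ` C)"
  unfolding measure_chain_def
proof (intro conjI ballI)
  show "(-) (space M) ` C \<subseteq> events" using assms by (auto simp: measure_chain_def)
next
  fix A' B' assume "A' \<in> (-) (space M) ` C" "B' \<in> (-) (space M) ` C"
  then obtain A B where AB: "A \<in> C" "B \<in> C" "A' = space M - A" "B' = space M - B" by blast
  have "prob A' = 1 - prob A" "prob B' = 1 - prob B"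
    using AB assms by (auto simp: measure_chain_def prob_compl)
  then show "A' = B' \<or> A' \<subseteq> B' \<and> prob A' < prob B' \<or> B' \<subseteq> A' \<and> prob B' < prob A'"
    using assms AB unfolding measure_chain_def by (auto; smt (verit) Diff_mono subset_refl subsetD)
qed

text \<open>
  If a maximal chain misses the value \<open>t\<close>, let \<open>L\<close> be the union of its members below \<open>t\<close> and \<open>R\<close> the
  intersection of those above. An event between \<open>L\<close> and \<open>R\<close>, namely \<open>L\<close> itself if both have measure
  \<open>t\<close> and one provided by atomlessness otherwise, could be added to the chain.
\<close>

lemma (in prob_space) atomless_measure_chain:
  assumes "atomless M"
  shows "\<exists>C. measure_chain M C \<and> (\<forall>t\<in>{0..1}. \<exists>A\<in>C. prob A = t)"
proof -
  have "\<exists>C\<in>{C. measure_chain M C}. \<forall>D\<in>{C. measure_chain M C}. C \<subseteq> D \<longrightarrow> D = C"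
  proof (rule subset_Zorn')
    fix S assume S: "subset.chain {C. measure_chain M C} S"
    then have lin: "X \<subseteq> Y \<or> Y \<subseteq> X" if "X \<in> S" "Y \<in> S" for X Y
      using that by (auto simp: subset_chain_def)
    have mem: "measure_chain M X" if "X \<in> S" for X using S that by (auto simp: subset_chain_def)
    \<comment> \<open>\<open>S\<close> is linearly ordered, so two events of its union already lie
      in one common chain.\<close>
    have "A = B \<or> A \<subseteq> B \<and> prob A < prob B \<or> B \<subseteq> A \<and> prob B < prob A"
      if AB: "A \<in> \<Union>S" "B \<in> \<Union>S" for A B
    proof -
      obtain X where "X \<in> S" "A \<in> X" "B \<in> X" using AB lin by blast
      then show ?thesis using mem[of X] unfolding measure_chain_def by blast
    qed
    then show "\<Union>S \<in> {C. measure_chain M C}"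
      using mem unfolding measure_chain_def by blast
  qed
  then obtain C where C: "measure_chain M C"
    and max: "\<And>D. measure_chain M D \<Longrightarrow> C \<subseteq> D \<Longrightarrow> D = C" by blast
  have "\<exists>A\<in>C. prob A = t" if t: "t \<in> {0..1}" for t
  proof (rule ccontr)
    assume no: "\<not> (\<exists>A\<in>C. prob A = t)"
    define L where "L = \<Union>{A\<in>C. prob A < t}"
    \<comment> \<open>The double complement makes \<open>R\<close> all of \<open>space M\<close>
      when no member exceeds \<open>t\<close>.\<close>
    define R where "R = space M - \<Union>((-) (space M) ` {A\<in>C. t < prob A})"
    have sub: "measure_chain M {A\<in>C. P A}" for P
      using C unfolding measure_chain_def by blast
    have L: "L \<in> events" "prob L \<le> t"
      using measure_chain_Union[OF sub[of "\<lambda>A. prob A < t"], of t] t by (auto simp: L_def)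
    have "\<Union>((-) (space M) ` {A\<in>C. t < prob A}) \<in> events \<and>
      prob (\<Union>((-) (space M) ` {A\<in>C. t < prob A})) \<le> 1 - t"
      using C t by (intro measure_chain_Union measure_chain_complement sub)
        (auto simp: measure_chain_def prob_compl)
    then have R: "R \<in> events" "t \<le> prob R" by (auto simp: R_def prob_compl)
    have low: "A \<subseteq> L" if "A \<in> C" "prob A < t" for A using that by (auto simp: L_def)
    have high: "R \<subseteq> A" if "A \<in> C" "t < prob A" for A using that by (auto simp: R_def)
    have LR: "L \<subseteq> R"
    proof
      fix x assume "x \<in> L"
      then obtain A where A: "A \<in> C" "prob A < t" "x \<in> A" by (auto simp: L_def)
      have "x \<in> B" if "B \<in> C" "t < prob B" for B
        using measure_chain_subset[OF C A(1) that(1)] A that by auto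
      moreover have "x \<in> space M"
        using A C sets.sets_into_space[of A M] by (auto simp: measure_chain_def)
      ultimately show "x \<in> R" by (auto simp: R_def)
    qed
    have gap: False
      if X: "X \<in> events" "L \<subseteq> X" "X \<subseteq> R" and lo: "\<And>A. A \<in> C \<Longrightarrow> prob A < t \<Longrightarrow> prob A < prob X"
        and hi: "\<And>A. A \<in> C \<Longrightarrow> t < prob A \<Longrightarrow> prob X < prob A" for X
    proof -
      have cmp: "A \<subseteq> X \<and> prob A < prob X \<or> X \<subseteq> A \<and> prob X < prob A" if "A \<in> C" for A
        using no that low high lo hi X by (metis linorder_neqE_linordered_idom order_trans)
      have "measure_chain M (insert X C)"
        using C cmp X unfolding measure_chain_def by blast
      \<comment> \<open>Maximality forces \<open>X\<close> into \<open>C\<close>, and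
        \<open>cmp\<close> for \<open>X\<close> itself then reads
        \<open>prob X < prob X\<close>.\<close>
      then have "X \<in> C" using max by blast
      then show False using cmp by blast
    qed
    have mono_low: "prob A \<le> prob L" if "A \<in> C" "prob A < t" for A
      using low[OF that] L(1) finite_measure_mono by blast
    have mono_high: "prob R \<le> prob A" if "A \<in> C" "t < prob A" for A
      using high[OF that] C that finite_measure_mono by (auto simp: measure_chain_def)
    show False
    proof (cases "prob L < prob R")
      case True
      \<comment> \<open>Members of \<open>C\<close> may have the measure of \<open>L\<close> or of
        \<open>R\<close>, so the new event must be strictly between the two in measure:
        \<open>L\<close> is enlarged by a part of \<open>R - L\<close> that has neither measure zero
        nor full measure.\<close>
      have "0 < prob (R - L)"
        using True finite_measure_Diff[OF R(1) L(1) LR] by simp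
      then obtain B where B: "B \<in> events" "B \<subseteq> R - L" "0 < prob B" "prob B < prob (R - L)"
        using assms R L unfolding atomless_def by (meson sets.Diff)
      have m: "prob (L \<union> B) = prob L + prob B"
        using B L by (intro finite_measure_Union) auto
      have "prob (R - L) = prob R - prob L" by (rule finite_measure_Diff[OF R(1) L(1) LR])
      then show False
        using B L LR m by (intro gap[of "L \<union> B"]) (auto dest: mono_low mono_high)
    next
      case False
      then have "prob L = t" using L R by simp
      then show False using L LR by (intro gap[of L]) auto
    qed
  qed
  then show ?thesis using C by blast
qed

text \<open>\<open>A t\<close> plays the part of the event \<open>W \<le> t\<close>, and
  \<open>W\<close> is recovered as the level up to which a point stays outside the chain. Only
  rational levels are used, so the supremum is countable and hence measurable.\<close>

lemma (in prob_space) atomless_uniform: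
  assumes "atomless M"
  obtains W where "W \<in> borel_measurable M" "\<And>\<omega>. 0 \<le> W \<omega>" "\<And>\<omega>. W \<omega> \<le> 1"
    "\<And>t. prob {\<omega>\<in>space M. W \<omega> \<le> t} = unit_cdf t"
proof -
  obtain C where C: "measure_chain M C" and ex: "\<And>t. t \<in> {0..1} \<Longrightarrow> \<exists>A\<in>C. prob A = t"
    using atomless_measure_chain[OF assms] by blast
  obtain A where A: "\<And>t. t \<in> {0..1} \<Longrightarrow> A t \<in> C \<and> prob (A t) = t"
    using ex by metis
  define Q where "Q = {0..1::real} \<inter> \<rat>"
  \<comment> \<open>A point inside \<open>A q\<close> contributes \<open>0\<close> instead of being
    left out, so the supremum runs over the fixed nonempty set \<open>Q\<close>.\<close>
  define W where "W \<omega> = (SUP q\<in>Q. q * indicator (- A q) \<omega>)" for \<omega>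
  have Q: "countable Q" "0 \<in> Q" "\<And>q. q \<in> Q \<Longrightarrow> q \<in> {0..1}"
    by (auto simp: Q_def countable_rat)
  have ev: "A t \<in> events" if "t \<in> {0..1}" for t
    using A[OF that] C by (auto simp: measure_chain_def)
  have bdd: "bdd_above ((\<lambda>q. q * indicator (- A q) \<omega>) ` Q)" for \<omega>
    using Q(3) by (auto intro!: bdd_aboveI[where M=1] simp: indicator_def)
  have W_le: "W \<omega> \<le> t \<longleftrightarrow> (\<forall>q\<in>Q. q * indicator (- A q) \<omega> \<le> t)" for \<omega> t
    unfolding W_def using Q(2) by (intro cSUP_le_iff bdd) auto
  have W0: "0 \<le> W \<omega>" for \<omega>
    using W_le[of \<omega> "W \<omega>"] Q(2) by force
  have W1: "W \<omega> \<le> 1" for \<omega>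
    using Q(3) by (auto simp: W_le indicator_def)
  have meas[measurable]: "W \<in> borel_measurable M"
    unfolding W_def
  proof (intro borel_measurable_cSUP Q(1) bdd)
    fix q assume "q \<in> Q"
    then have [measurable]: "A q \<in> events" using ev Q(3) by blast
    show "(\<lambda>\<omega>. q * indicator (- A q) \<omega>) \<in> borel_measurable M"
      unfolding indicator_compl by measurable
  qed
  have "prob {\<omega>\<in>space M. W \<omega> \<le> t} = unit_cdf t" for t
  proof -
    consider "t < 0" | "1 \<le> t" | "0 \<le> t" "t < 1" by linarith
    then show ?thesis
    proof cases
      case 1
      then have "{\<omega>\<in>space M. W \<omega> \<le> t} = {}" using W0 by (auto simp: not_le intro: less_le_trans)
      then show ?thesis using 1 by (simp only: measure_empty) (simp add: unit_cdf_def)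
    next
      case 2
      then have "{\<omega>\<in>space M. W \<omega> \<le> t} = space M" using W1 by (auto intro: order_trans)
      then show ?thesis using 2 by (simp only: prob_space) (simp add: unit_cdf_def)
    next
      case 3
      then have t: "t \<in> {0..1}" by simp
      \<comment> \<open>For \<open>q \<le> t\<close> the bound is trivial; for larger
        \<open>q\<close> the event \<open>A q\<close> contains \<open>A t\<close>, so the term
        vanishes.\<close>
      have "A t \<subseteq> {\<omega>\<in>space M. W \<omega> \<le> t}"
      proof
        fix \<omega> assume w: "\<omega> \<in> A t"
        have "q * indicator (- A q) \<omega> \<le> t" if "q \<in> Q" for q
        proof (cases "q \<le> t")
          case False
          then have "A t \<subseteq> A q" using measure_chain_subset[OF C] A[OF t] A[OF Q(3)[OF that]] by auto
          then show ?thesis using w t by auto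
        qed (use t Q(3)[OF that] in \<open>auto simp: indicator_def\<close>)
        then show "\<omega> \<in> {\<omega>\<in>space M. W \<omega> \<le> t}"
          using w sets.sets_into_space[OF ev[OF t]] by (auto simp: W_le)
      qed
      then have "t \<le> prob {\<omega>\<in>space M. W \<omega> \<le> t}"
        using finite_measure_mono[of "A t" "{\<omega>\<in>space M. W \<omega> \<le> t}"] A[OF t] by simp
      \<comment> \<open>The inclusion holds in \<open>A q\<close> for rational \<open>q > t\<close>,
        so the bound \<open>t\<close> is approached through levels \<open>u > t\<close> with a
        rational in between.\<close>
      moreover have "prob {\<omega>\<in>space M. W \<omega> \<le> t} \<le> t"
      proof (rule dense_ge_bounded[OF 3(2)])
        fix u assume u: "t < u" "u < 1"
        obtain q where q: "q \<in> \<rat>" "t < q" "q < u" using Rats_dense_in_real[OF u(1)] by blast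
        then have qQ: "q \<in> Q" using 3 u by (auto simp: Q_def)
        have "{\<omega>\<in>space M. W \<omega> \<le> t} \<subseteq> A q"
        proof
          fix \<omega> assume "\<omega> \<in> {\<omega>\<in>space M. W \<omega> \<le> t}"
          then have "q * indicator (- A q) \<omega> \<le> t" using qQ W_le by blast
          then show "\<omega> \<in> A q" using q by (cases "\<omega> \<in> A q") auto
        qed
        then have "prob {\<omega>\<in>space M. W \<omega> \<le> t} \<le> prob (A q)"
          using ev Q(3)[OF qQ] by (intro finite_measure_mono) auto
        then show "prob {\<omega>\<in>space M. W \<omega> \<le> t} \<le> u" using A[OF Q(3)[OF qQ]] q by linarith
      qed
      ultimately show ?thesis using 3 by (simp add: unit_cdf_def)
    qed
  qed
  with that W0 W1 meas show thesis by blast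
qed


section \<open>Coupling a finite-valued variable with an independent uniform one\<close>

lemma unit_cdf_0 [simp]: "u \<le> 0 \<Longrightarrow> unit_cdf u = 0"
  and unit_cdf_1 [simp]: "1 \<le> u \<Longrightarrow> unit_cdf u = 1"
  and unit_cdf_id [simp]: "0 \<le> u \<Longrightarrow> u \<le> 1 \<Longrightarrow> unit_cdf u = u"
  by (auto simp: unit_cdf_def)

lemma unit_cdf_bounds: "0 \<le> unit_cdf u" "unit_cdf u \<le> 1"
  by (auto simp: unit_cdf_def)

text \<open>Given the piece into which \<open>W\<close> falls, its relative position there is
  uniform, whatever the piece. The product formula encodes three facts at once: \<open>K\<close> has
  the law of \<open>K'\<close> (\<open>u = 1\<close>), \<open>U\<close> is uniform
  (\<open>Q = UNIV\<close>), and the two are independent.\<close>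

lemma (in prob_space) atomless_coupling:
  fixes N :: "'c measure" and K' :: "'c \<Rightarrow> 'b"
  assumes "atomless M" and N: "prob_space N" and K': "K' \<in> measurable N (count_space UNIV)"
    and T: "finite T" "\<And>x. x \<in> space N \<Longrightarrow> K' x \<in> T"
  obtains K U where "K \<in> measurable M (count_space UNIV)" "U \<in> borel_measurable M"
    "\<And>Q u. prob {\<omega>\<in>space M. K \<omega> \<in> Q \<and> U \<omega> \<le> u} = unit_cdf u * measure N {x\<in>space N. K' x \<in> Q}"
proof -
  interpret N: prob_space N by fact
  note [measurable] = K'
  obtain W where W[measurable]: "W \<in> borel_measurable M" and W01: "\<And>\<omega>. 0 \<le> W \<omega>" "\<And>\<omega>. W \<omega> \<le> 1"
    and cdf_W: "\<And>t. prob {\<omega>\<in>space M. W \<omega> \<le> t} = unit_cdf t"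
    using atomless_uniform[OF assms(1)] by metis
  obtain h where h: "bij_betw h {0..<card T} T"
    using ex_bij_betw_nat_finite[OF T(1)] by blast
  define n where "n = card T"
  define q where "q k = N.prob {x\<in>space N. K' x = h k}" for k
  define c where "c k = (\<Sum>j<k. q j)" for k
  have inj: "inj_on h {..<n}" and img: "h ` {..<n} = T"
    using h by (auto simp: bij_betw_def n_def atLeast0LessThan)
  have q0: "0 \<le> q k" for k by (simp add: q_def)
  have sum_q: "N.prob {x\<in>space N. K' x \<in> Q} = (\<Sum>k | k < n \<and> h k \<in> Q. q k)" for Q
  proof -
    have "{x\<in>space N. K' x \<in> Q} = (\<Union>k\<in>{k. k < n \<and> h k \<in> Q}. {x\<in>space N. K' x = h k})"
      using T(2) img by auto (metis image_iff lessThan_iff)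
    moreover have "disjoint_family_on (\<lambda>k. {x\<in>space N. K' x = h k}) {k. k < n \<and> h k \<in> Q}"
      using inj by (auto simp: disjoint_family_on_def inj_on_def)
    ultimately show ?thesis
      unfolding q_def by (simp add: N.finite_measure_finite_Union image_subset_iff)
  qed
  have c0: "c 0 = 0" by (simp add: c_def)
  have cn: "c n = 1"
    using sum_q[of UNIV] N.prob_space by (simp add: c_def lessThan_def)
  have c_Suc: "c (Suc k) = c k + q k" for k by (simp add: c_def)
  have c_mono: "c j \<le> c k" if "j \<le> k" for j k
    using that q0 by (auto simp: c_def intro!: sum_mono2)
  \<comment> \<open>The number of the piece \<open>(c k, c (Suc k)]\<close> containing
    \<open>W\<close>. The value \<open>W = 0\<close> lies in no such half-open piece, hence the
    recourse to \<open>W_pos\<close> below.\<close>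
  define \<kappa> where "\<kappa> \<omega> = (LEAST k. W \<omega> \<le> c (Suc k))" for \<omega>
  define K where "K \<omega> = h (\<kappa> \<omega>)" for \<omega>
  \<comment> \<open>If \<open>q (\<kappa> \<omega>) = 0\<close>, division returns \<open>0\<close>.
    This happens only on a null event, as a piece of length zero contains no positive value of
    \<open>W\<close>.\<close>
  define U where "U \<omega> = (W \<omega> - c (\<kappa> \<omega>)) / q (\<kappa> \<omega>)" for \<omega>
  have [measurable]: "\<kappa> \<in> measurable M (count_space UNIV)"
    unfolding \<kappa>_def by measurable
  have K[measurable]: "K \<in> measurable M (count_space UNIV)"
    unfolding K_def by measurable
  have U[measurable]: "U \<in> borel_measurable M"
    unfolding U_def by (rule measurable_compose_countable[of "\<lambda>k \<omega>. (W \<omega> - c k) / q k"]) measurable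
  have "n \<noteq> 0" using cn c0 by (intro notI) simp
  have \<kappa>_n: "\<kappa> \<omega> < n" for \<omega>
  proof -
    have "\<kappa> \<omega> \<le> n - 1" unfolding \<kappa>_def
      using W01(2)[of \<omega>] cn \<open>n \<noteq> 0\<close> by (intro Least_le) simp
    then show ?thesis using \<open>n \<noteq> 0\<close> by simp
  qed
  have \<kappa>_iff: "\<kappa> \<omega> = k \<longleftrightarrow> c k < W \<omega> \<and> W \<omega> \<le> c (Suc k)" if "0 < W \<omega>" for \<omega> k
  proof
    assume k: "\<kappa> \<omega> = k"
    have "W \<omega> \<le> c (Suc (n - 1))" using W01(2)[of \<omega>] cn \<open>n \<noteq> 0\<close> by simp
    then have "W \<omega> \<le> c (Suc k)"
      unfolding k[symmetric] \<kappa>_def by (rule LeastI)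
    moreover have "c k < W \<omega>"
    proof (cases k)
      case (Suc j)
      then have "\<not> W \<omega> \<le> c (Suc j)"
        using k unfolding \<kappa>_def by (intro not_less_Least) simp
      then show ?thesis using Suc by simp
    qed (use that c0 in simp)
    ultimately show "c k < W \<omega> \<and> W \<omega> \<le> c (Suc k)" by blast
  next
    assume *: "c k < W \<omega> \<and> W \<omega> \<le> c (Suc k)"
    show "\<kappa> \<omega> = k" unfolding \<kappa>_def
    proof (rule Least_equality)
      fix j assume "W \<omega> \<le> c (Suc j)"
      then show "k \<le> j" using * c_mono[of "Suc j" k] by (meson not_le not_less_eq_eq order.trans order.strict_trans2 order_less_irrefl)
    qed (use * in simp)
  qed
  have W_pos: "AE \<omega> in M. 0 < W \<omega>"
  proof -
    have "prob {\<omega>\<in>space M. W \<omega> \<le> 0} = 0" by (simp add: cdf_W)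
    then have "AE \<omega> in M. \<omega> \<notin> {\<omega>\<in>space M. W \<omega> \<le> 0}" by (subst (asm) prob_eq_0) auto
    then show ?thesis by (rule AE_mp) (auto simp: not_le)
  qed
  have W_int: "prob {\<omega>\<in>space M. a < W \<omega> \<and> W \<omega> \<le> b} = b - a" if "0 \<le> a" "a \<le> b" "b \<le> 1" for a b
  proof -
    have "{\<omega>\<in>space M. a < W \<omega> \<and> W \<omega> \<le> b} = {\<omega>\<in>space M. W \<omega> \<le> b} - {\<omega>\<in>space M. W \<omega> \<le> a}" by auto
    also have "prob \<dots> = prob {\<omega>\<in>space M. W \<omega> \<le> b} - prob {\<omega>\<in>space M. W \<omega> \<le> a}"
      using that by (intro finite_measure_Diff) auto
    finally show ?thesis using that by (simp add: cdf_W)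
  qed
  \<comment> \<open>Within piece \<open>k\<close> the condition \<open>U \<le> u\<close> cuts off an
    initial segment of relative length \<open>unit_cdf u\<close>; levels outside
    \<open>[0, 1]\<close> give nothing or the full piece.\<close>
  have piece: "prob {\<omega>\<in>space M. \<kappa> \<omega> = k \<and> U \<omega> \<le> u} = unit_cdf u * q k" if "k < n" for k u
  proof -
    have "prob {\<omega>\<in>space M. \<kappa> \<omega> = k \<and> U \<omega> \<le> u}
      = prob {\<omega>\<in>space M. c k < W \<omega> \<and> W \<omega> \<le> c k + unit_cdf u * q k}"
    proof (rule finite_measure_eq_AE)
      show "AE \<omega> in M. \<omega> \<in> {\<omega>\<in>space M. \<kappa> \<omega> = k \<and> U \<omega> \<le> u} \<longleftrightarrow>
          \<omega> \<in> {\<omega>\<in>space M. c k < W \<omega> \<and> W \<omega> \<le> c k + unit_cdf u * q k}"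
        using W_pos
      proof eventually_elim
        case (elim \<omega>)
        show ?case
        proof (cases "c k < W \<omega>")
          case False
          then show ?thesis using elim by (auto simp: \<kappa>_iff)
        next
          case W: True
          show ?thesis
          proof (cases "q k = 0")
            case True
            then show ?thesis using elim by (auto simp: \<kappa>_iff c_Suc)
          next
            case False
            then have "0 < q k" using q0[of k] by simp
            then have "(W \<omega> - c k) / q k \<le> u \<longleftrightarrow> W \<omega> \<le> c k + u * q k"
              by (simp add: field_simps)
            moreover have "u * q k \<le> 0 \<longleftrightarrow> u \<le> 0" "q k \<le> u * q k \<longleftrightarrow> 1 \<le> u"
              using \<open>0 < q k\<close> by (auto simp: mult_le_0_iff)
            moreover have "\<kappa> \<omega> = k \<and> U \<omega> \<le> u \<longleftrightarrow> \<kappa> \<omega> = k \<and> (W \<omega> - c k) / q k \<le> u"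
              by (auto simp: U_def)
            ultimately show ?thesis using elim W
              by (cases "u \<le> 0"; cases "1 \<le> u") (auto simp: \<kappa>_iff c_Suc)
          qed
        qed
      qed
    qed measurable
    also have "\<dots> = unit_cdf u * q k"
    proof -
      have "unit_cdf u * q k \<le> 1 * q k"
        using unit_cdf_bounds q0 by (intro mult_right_mono) auto
      moreover have "c k + q k \<le> 1" using c_mono[of "Suc k" n] that by (simp add: c_Suc cn)
      ultimately show ?thesis
        using W_int[of "c k" "c k + unit_cdf u * q k"] c_mono[of 0 k] unit_cdf_bounds q0[of k] by (simp add: c0)
    qed
    finally show ?thesis .
  qed
  have "prob {\<omega>\<in>space M. K \<omega> \<in> Q \<and> U \<omega> \<le> u} = unit_cdf u * N.prob {x\<in>space N. K' x \<in> Q}" for Q u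
  proof -
    have "{\<omega>\<in>space M. K \<omega> \<in> Q \<and> U \<omega> \<le> u}
        = (\<Union>k\<in>{k. k < n \<and> h k \<in> Q}. {\<omega>\<in>space M. \<kappa> \<omega> = k \<and> U \<omega> \<le> u})"
      using \<kappa>_n by (auto simp: K_def)
    also have "prob \<dots> = (\<Sum>k | k < n \<and> h k \<in> Q. prob {\<omega>\<in>space M. \<kappa> \<omega> = k \<and> U \<omega> \<le> u})"
      by (rule finite_measure_finite_Union) (auto simp: disjoint_family_on_def)
    also have "\<dots> = unit_cdf u * N.prob {x\<in>space N. K' x \<in> Q}"
      by (simp add: piece sum_q sum_distrib_left)
    finally show ?thesis .
  qed
  with that K U show thesis by blast
qed


section \<open>Tail dependence of the mixture vector\<close>

lemma (in prob_space) expectation_zero_one: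
  assumes [measurable]: "X \<in> borel_measurable M" and "AE \<omega> in M. X \<omega> \<in> {0, 1::real}"
  shows "expectation X = prob {\<omega>\<in>space M. X \<omega> = 1}"
proof -
  have "expectation X = expectation (indicator {\<omega>\<in>space M. X \<omega> = 1})"
    using assms(2) by (intro integral_cong_AE) (auto simp: indicator_def)
  then show ?thesis by simp
qed

lemma (in prob_space) expectation_zero_one_mult:
  assumes [measurable]: "X \<in> borel_measurable M" "Y \<in> borel_measurable M"
    and X: "AE \<omega> in M. X \<omega> \<in> {0, 1::real}" and Y: "AE \<omega> in M. Y \<omega> \<in> {0, 1::real}"
  shows "expectation (\<lambda>\<omega>. X \<omega> * Y \<omega>) = prob {\<omega>\<in>space M. X \<omega> = 1 \<and> Y \<omega> = 1}"
proof -
  have "expectation (\<lambda>\<omega>. X \<omega> * Y \<omega>) = prob {\<omega>\<in>space M. X \<omega> * Y \<omega> = 1}"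
    using X Y by (intro expectation_zero_one) auto
  also have "\<dots> = prob {\<omega>\<in>space M. X \<omega> = 1 \<and> Y \<omega> = 1}"
    using X Y by (intro finite_measure_eq_AE) auto
  finally show ?thesis .
qed

text \<open>Near zero only the part \<open>p * U\<close> contributes. Independence is expressed by
  two separate factorisations, one for \<open>U\<close> and one for \<open>V\<close>, so that the
  same result serves general mixtures and the coupling with \<open>V = U\<close>.\<close>

lemma (in prob_space) mixture_tail_dependence:
  assumes p: "0 < p" "p \<le> 1"
    and [measurable]: "U \<in> borel_measurable M" "V \<in> borel_measurable M"
    and X[measurable]: "\<And>i. i \<in> {1..d} \<Longrightarrow> X i \<in> borel_measurable M"
    and X01: "\<And>i. i \<in> {1..d} \<Longrightarrow> AE \<omega> in M. X i \<omega> \<in> {0, 1}"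
    and mean: "\<And>i. i \<in> {1..d} \<Longrightarrow> expectation (X i) = p"
    and U: "\<And>i j u. i \<in> {1..d} \<Longrightarrow> j \<in> {1..d} \<Longrightarrow>
      prob {\<omega>\<in>space M. X i \<omega> = 1 \<and> X j \<omega> = 1 \<and> U \<omega> \<le> u}
        = unit_cdf u * prob {\<omega>\<in>space M. X i \<omega> = 1 \<and> X j \<omega> = 1}"
    and V: "\<And>i u. i \<in> {1..d} \<Longrightarrow>
      prob {\<omega>\<in>space M. X i \<omega> = 0 \<and> V \<omega> \<le> u} = unit_cdf u * prob {\<omega>\<in>space M. X i \<omega> = 0}"
    and L: "\<And>i j. i \<in> {1..d} \<Longrightarrow> j \<in> {1..d} \<Longrightarrow>
      expectation (\<lambda>\<omega>. X i \<omega> * X j \<omega>) = L i j * p"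
  shows "has_tail_dependence_matrix M d (mixture_vector p U V X) L"
proof -
  define Y where "Y = mixture_vector p U V X"
  have Y_1: "Y i \<omega> = p * U \<omega>" if "X i \<omega> = 1" for i \<omega>
    using that by (simp add: Y_def mixture_vector_def)
  have Y_0: "Y i \<omega> = p + (1 - p) * V \<omega>" if "X i \<omega> = 0" for i \<omega>
    using that by (simp add: Y_def mixture_vector_def)
  have Y[measurable]: "Y i \<in> borel_measurable M" if "i \<in> {1..d}" for i
    using X[OF that] unfolding Y_def mixture_vector_def[abs_def] by measurable
  have pX1: "prob {\<omega>\<in>space M. X i \<omega> = 1} = p" if "i \<in> {1..d}" for i
    using expectation_zero_one[OF X[OF that] X01[OF that]] mean[OF that] by simp
  have pX0: "prob {\<omega>\<in>space M. X i \<omega> = 0} = 1 - p" if i: "i \<in> {1..d}" for i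
  proof -
    note [measurable] = X[OF i]
    have "prob {\<omega>\<in>space M. X i \<omega> = 0} = prob (space M - {\<omega>\<in>space M. X i \<omega> = 1})"
      using X01[OF i] by (intro finite_measure_eq_AE) auto
    also have "\<dots> = 1 - p" by (subst prob_compl) (auto simp: pX1[OF i])
    finally show ?thesis .
  qed
  \<comment> \<open>\<open>Y i\<close> is uniform on \<open>[0, p]\<close> given
    \<open>X i = 1\<close> and on \<open>[p, 1]\<close> given \<open>X i = 0\<close>. The weights
    \<open>p\<close> and \<open>1 - p\<close> are the lengths of these intervals, so the mixture is
    uniform on \<open>[0, 1]\<close>.\<close>
  have cdf_Y: "prob {\<omega>\<in>space M. Y i \<omega> \<le> y} = unit_cdf y" if i: "i \<in> {1..d}" for i y
  proof -
    note [measurable] = X[OF i] Y[OF i]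
    let ?A = "{\<omega>\<in>space M. X i \<omega> = 1 \<and> U \<omega> \<le> y / p}"
    let ?B = "{\<omega>\<in>space M. X i \<omega> = 0 \<and> p + (1 - p) * V \<omega> \<le> y}"
    have "prob {\<omega>\<in>space M. Y i \<omega> \<le> y} = prob (?A \<union> ?B)"
    proof (rule finite_measure_eq_AE)
      show "AE \<omega> in M. \<omega> \<in> {\<omega>\<in>space M. Y i \<omega> \<le> y} \<longleftrightarrow> \<omega> \<in> ?A \<union> ?B"
        using X01[OF i] by eventually_elim (use p in \<open>auto simp: Y_0 Y_1 field_simps\<close>)
    qed measurable
    also have "\<dots> = prob ?A + prob ?B"
      by (intro finite_measure_Union) auto
    also have "prob ?A = unit_cdf (y / p) * p"
      using U[OF i i] pX1[OF i] by simp
    also have "prob ?B = unit_cdf ((y - p) / (1 - p)) * (1 - p)"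
    proof (cases "p = 1")
      \<comment> \<open>Here the argument of \<open>unit_cdf\<close> is a division by zero, but the
        factor \<open>1 - p\<close> vanishes and \<open>X i = 0\<close> is a null event.\<close>
      case True
      have "prob ?B \<le> prob {\<omega>\<in>space M. X i \<omega> = 0}" by (intro finite_measure_mono) auto
      then show ?thesis using True pX0[OF i] by (simp add: measure_le_0_iff)
    next
      case False
      then have "?B = {\<omega>\<in>space M. X i \<omega> = 0 \<and> V \<omega> \<le> (y - p) / (1 - p)}"
        using p by (auto simp: field_simps)
      then show ?thesis using V[OF i] pX0[OF i] by simp
    qed
    also have "unit_cdf (y / p) * p + unit_cdf ((y - p) / (1 - p)) * (1 - p) = unit_cdf y"
    proof -
      have 1: "unit_cdf (y / p) * p = max 0 (min p y)"
        using p by (auto simp: unit_cdf_def max_def min_def field_simps)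
      have 2: "unit_cdf ((y - p) / (1 - p)) * (1 - p) = max 0 (min (1 - p) (y - p))"
        using p by (cases "p = 1") (auto simp: unit_cdf_def max_def min_def field_simps)
      show ?thesis unfolding 1 2 using p by (auto simp: unit_cdf_def)
    qed
    finally show ?thesis .
  qed
  have F: "dist_fun M (Y i) = unit_cdf" if i: "i \<in> {1..d}" for i
  proof
    fix y
    have "dist_fun M (Y i) y = prob (Y i -` {..y} \<inter> space M)"
      using Y[OF i] by (simp add: dist_fun_def cdf_def measure_distr)
    also have "Y i -` {..y} \<inter> space M = {\<omega>\<in>space M. Y i \<omega> \<le> y}" by auto
    finally show "dist_fun M (Y i) y = unit_cdf y" using cdf_Y[OF i] by simp
  qed
  \<comment> \<open>Keeps \<open>Y i\<close> at or above \<open>p\<close> almost surely where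
    \<open>X i = 0\<close>, hence out of the event \<open>Y i \<le> u\<close> for every
    \<open>u < p\<close>.\<close>
  have V_pos: "AE \<omega> in M. X i \<omega> = 0 \<longrightarrow> 0 < V \<omega>" if i: "i \<in> {1..d}" for i
  proof -
    note [measurable] = X[OF i]
    have "prob {\<omega>\<in>space M. X i \<omega> = 0 \<and> V \<omega> \<le> 0} = 0" by (simp add: V[OF i])
    then have "AE \<omega> in M. \<omega> \<notin> {\<omega>\<in>space M. X i \<omega> = 0 \<and> V \<omega> \<le> 0}" by (subst (asm) prob_eq_0) auto
    then show ?thesis by (rule AE_mp) (auto simp: not_le)
  qed
  have tail: "has_tail_dependence_coeff M (Y i) (Y j) (L i j)"
    if i: "i \<in> {1..d}" and j: "j \<in> {1..d}" for i j
    unfolding has_tail_dependence_coeff_def F[OF i] F[OF j]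
  proof (rule tendsto_eventually)
    note [measurable] = X[OF i] Y[OF i] X[OF j] Y[OF j]
    \<comment> \<open>The quotient is constant on \<open>0 < u < p\<close>, so the limit requires no
      estimate.\<close>
    have "1 / u * prob {\<omega>\<in>space M. unit_cdf (Y i \<omega>) \<le> u \<and> unit_cdf (Y j \<omega>) \<le> u} = L i j"
      if u: "0 < u" "u < p" for u
    proof -
      have cdf_le: "unit_cdf y \<le> u \<longleftrightarrow> y \<le> u" for y
        using u p by (auto simp: unit_cdf_def)
      have "prob {\<omega>\<in>space M. Y i \<omega> \<le> u \<and> Y j \<omega> \<le> u}
        = prob {\<omega>\<in>space M. X i \<omega> = 1 \<and> X j \<omega> = 1 \<and> U \<omega> \<le> u / p}"
      proof (rule finite_measure_eq_AE)
        have 0: "\<not> Y k \<omega> \<le> u" if "X k \<omega> = 0" "0 < V \<omega>" for k \<omega>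
        proof -
          have "0 \<le> (1 - p) * V \<omega>" using p that by simp
          then show ?thesis using u by (simp add: Y_0[OF that(1)])
        qed
        show "AE \<omega> in M. \<omega> \<in> {\<omega>\<in>space M. Y i \<omega> \<le> u \<and> Y j \<omega> \<le> u} \<longleftrightarrow>
            \<omega> \<in> {\<omega>\<in>space M. X i \<omega> = 1 \<and> X j \<omega> = 1 \<and> U \<omega> \<le> u / p}"
          using X01[OF i] X01[OF j] V_pos[OF i] V_pos[OF j]
        proof eventually_elim
          case (elim \<omega>)
          have 1: "Y k \<omega> \<le> u \<longleftrightarrow> U \<omega> \<le> u / p" if "X k \<omega> = 1" for k
            using p by (simp add: Y_1[OF that] field_simps)
          show ?case using elim by (auto simp: 0 1)
        qed
      qed measurable
      also have "\<dots> = u / p * (L i j * p)"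
        using U[OF i j] u p L[OF i j, symmetric]
          expectation_zero_one_mult[OF X[OF i] X[OF j] X01[OF i] X01[OF j]] by simp
      finally show ?thesis using u p by (simp add: cdf_le)
    qed
    then show "\<forall>\<^sub>F u in at_right 0. 1 / u *
        prob {\<omega>\<in>space M. unit_cdf (Y i \<omega>) \<le> u \<and> unit_cdf (Y j \<omega>) \<le> u} = L i j"
      unfolding eventually_at_right_field using p by blast
  qed
  have "continuous_on UNIV unit_cdf"
    unfolding unit_cdf_def by (intro continuous_intros)
  with tail F Y show ?thesis
    unfolding has_tail_dependence_matrix_def Y_def[symmetric] by simp
qed

lemma uniform_rv_prob:
  assumes "uniform_rv M Z a b" "a < b" "A \<in> sets borel"
  shows "measure M {\<omega>\<in>space M. Z \<omega> \<in> A} = measure lborel ({a..b} \<inter> A) / (b - a)"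
proof -
  have Z: "Z \<in> borel_measurable M" "distr M borel Z = uniform_measure lborel {a..b}"
    using assms by (auto simp: uniform_rv_def)
  have "measure M {\<omega>\<in>space M. Z \<omega> \<in> A} = measure (distr M borel Z) A"
    using Z(1) assms(3) by (simp add: measure_distr vimage_def Int_def conj_commute)
  also have "\<dots> = measure lborel ({a..b} \<inter> A) / (b - a)"
    unfolding Z(2) using assms(2,3) by (subst measure_uniform_measure) simp_all
  finally show ?thesis .
qed

text \<open>Each factorisation concerns events determined by the vector \<open>X\<close> and by one
  of \<open>U\<close> and \<open>V\<close>, so independence of the generated sigma-algebras supplies
  it. For a concrete mixture only the second moments remain to be computed.\<close>

lemma (in prob_space) mixture_setting_tail_dependence:
  assumes mix: "mixture_setting M d p U V X"
    and L: "\<And>i j. i \<in> {1..d} \<Longrightarrow> j \<in> {1..d} \<Longrightarrow> expectation (\<lambda>\<omega>. X i \<omega> * X j \<omega>) = L i j * p"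
  shows "has_tail_dependence_matrix M d (mixture_vector p U V X) L"
proof -
  define XX where "XX \<omega> = (\<lambda>i\<in>{1..d}. X i \<omega>)" for \<omega>
  let ?P = "Pi\<^sub>M {1..d} (\<lambda>_. borel :: real measure)"
  have cdf: "prob {\<omega>\<in>space M. Z \<omega> \<le> u} = unit_cdf u" if "uniform_rv M Z 0 1" for Z u
  proof -
    have "{0..1} \<inter> {..u} = {0..min 1 u}" by auto
    then show ?thesis
      using uniform_rv_prob[OF that, of "{..u}"] by (auto simp: unit_cdf_def)
  qed
  have indep: "prob {\<omega>\<in>space M. XX \<omega> \<in> B \<and> Z \<omega> \<le> u} = unit_cdf u * prob {\<omega>\<in>space M. XX \<omega> \<in> B}"
    if B: "B \<in> sets ?P" and Z: "Z = U \<and> k = 0 \<or> Z = V \<and> k = (1::nat)" for B Z k u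
  proof -
    have ev: "{\<omega>\<in>space M. XX \<omega> \<in> B} \<in> sets (vimage_algebra (space M) XX ?P)"
      using in_vimage_algebra[OF B, of XX "space M"] by (simp add: vimage_def Int_def conj_commute)
    have ev': "{\<omega>\<in>space M. Z \<omega> \<le> u} \<in> sets (vimage_algebra (space M) Z borel)"
      using in_vimage_algebra[of "{..u}" borel Z "space M"] by (simp add: vimage_def Int_def conj_commute)
    \<comment> \<open>In the list of \<open>indep_triple\<close> position \<open>2\<close> belongs
      to the vector \<open>X\<close>, and \<open>k\<close> selects \<open>U\<close> or
      \<open>V\<close>.\<close>
    have "prob (\<Inter>l\<in>{k, 2}. if l = 2 then {\<omega>\<in>space M. XX \<omega> \<in> B} else {\<omega>\<in>space M. Z \<omega> \<le> u})
      = (\<Prod>l\<in>{k, 2}. prob (if l = 2 then {\<omega>\<in>space M. XX \<omega> \<in> B} else {\<omega>\<in>space M. Z \<omega> \<le> u}))"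
      using mix ev ev' Z unfolding mixture_setting_def indep_triple_def XX_def[symmetric]
      by (intro indep_setsD[where I = "{..<3}"]) auto
    moreover have "{\<omega>\<in>space M. XX \<omega> \<in> B} \<inter> {\<omega>\<in>space M. Z \<omega> \<le> u} = {\<omega>\<in>space M. XX \<omega> \<in> B \<and> Z \<omega> \<le> u}"
      by auto
    moreover have "prob {\<omega>\<in>space M. Z \<omega> \<le> u} = unit_cdf u"
      using cdf Z mix unfolding mixture_setting_def by blast
    ultimately show ?thesis using Z by auto
  qed
  show ?thesis
  proof (rule mixture_tail_dependence[OF _ _ _ _ _ _ _ _ _ L])
    fix i j u assume ij: "i \<in> {1..d}" "j \<in> {1..d}"
    have [measurable]: "(\<lambda>f. f i) \<in> borel_measurable ?P" "(\<lambda>f. f j) \<in> borel_measurable ?P"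
      using ij by simp_all
    have "{f\<in>space ?P. f i = 1 \<and> f j = 1} \<in> sets ?P" by measurable
    from indep[OF this, of U 0 u]
    show "prob {\<omega>\<in>space M. X i \<omega> = 1 \<and> X j \<omega> = 1 \<and> U \<omega> \<le> u}
        = unit_cdf u * prob {\<omega>\<in>space M. X i \<omega> = 1 \<and> X j \<omega> = 1}"
      using ij by (simp add: XX_def space_PiM)
  next
    fix i u assume i: "i \<in> {1..d}"
    have [measurable]: "(\<lambda>f. f i) \<in> borel_measurable ?P" using i by simp
    have "{f\<in>space ?P. f i = 0} \<in> sets ?P" by measurable
    from indep[OF this, of V 1 u]
    show "prob {\<omega>\<in>space M. X i \<omega> = 0 \<and> V \<omega> \<le> u} = unit_cdf u * prob {\<omega>\<in>space M. X i \<omega> = 0}"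
      using i by (simp add: XX_def space_PiM)
  qed (use mix in \<open>auto simp: mixture_setting_def uniform_rv_def\<close>)
qed

text \<open>The second moments see \<open>X\<close> only through the random set of indices with
  \<open>X i = 1\<close>, which takes finitely many values. Its law is transported to
  \<open>M\<close> by the coupling, so \<open>X\<close> may be built on any convenient space
  \<open>N\<close>.\<close>

lemma (in prob_space) atomless_is_tail_dependence_matrix:
  fixes N :: "'c measure" and X :: "nat \<Rightarrow> 'c \<Rightarrow> real"
  assumes "atomless M" and N: "prob_space N" and p: "0 < p" "p \<le> 1"
    and X: "\<And>i. i \<in> {1..d} \<Longrightarrow> X i \<in> borel_measurable N"
      "\<And>i. i \<in> {1..d} \<Longrightarrow> AE \<omega> in N. X i \<omega> \<in> {0, 1}"
      "\<And>i. i \<in> {1..d} \<Longrightarrow> integral\<^sup>L N (X i) = p"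
    and L: "\<And>i j. i \<in> {1..d} \<Longrightarrow> j \<in> {1..d} \<Longrightarrow> integral\<^sup>L N (\<lambda>\<omega>. X i \<omega> * X j \<omega>) = L i j * p"
  shows "is_tail_dependence_matrix M d L"
proof -
  interpret N: prob_space N by fact
  define K' where "K' \<omega> = {i\<in>{1..d}. X i \<omega> = 1}" for \<omega>
  have fin: "finite (Pow {1..d})" by simp
  have "K' \<in> measurable N (count_space (Pow {1..d}))"
    unfolding measurable_count_space_eq2[OF fin]
  proof (intro conjI ballI)
    fix S assume S: "S \<in> Pow {1..d}"
    have X1: "{\<omega>\<in>space N. X i \<omega> = 1 \<longleftrightarrow> i \<in> S} \<in> sets N" if "i \<in> {1..d}" for i
    proof -
      note [measurable] = X(1)[OF that]
      show ?thesis by (cases "i \<in> S") auto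
    qed
    have "K' \<omega> = S \<longleftrightarrow> (\<forall>i\<in>{1..d}. X i \<omega> = 1 \<longleftrightarrow> i \<in> S)" for \<omega>
      using S unfolding K'_def by blast
    then have "K' -` {S} \<inter> space N = {\<omega>\<in>space N. \<forall>i\<in>{1..d}. X i \<omega> = 1 \<longleftrightarrow> i \<in> S}"
      by (simp add: vimage_def Int_def conj_commute)
    also have "\<dots> \<in> sets N" by (intro sets.sets_Collect_finite_All X1) auto
    finally show "K' -` {S} \<inter> space N \<in> sets N" .
  next
    show "K' \<in> space N \<rightarrow> Pow {1..d}" unfolding K'_def by blast
  qed
  then have K'_meas: "K' \<in> measurable N (count_space UNIV)"
    by (rule measurable_compose) simp
  then obtain K U where K[measurable]: "K \<in> measurable M (count_space UNIV)"
    and U[measurable]: "U \<in> borel_measurable M"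
    and KU: "\<And>Q u. prob {\<omega>\<in>space M. K \<omega> \<in> Q \<and> U \<omega> \<le> u} = unit_cdf u * N.prob {x\<in>space N. K' x \<in> Q}"
    using atomless_coupling[OF assms(1) N K'_meas fin] unfolding K'_def by blast
  have K_distr: "prob {\<omega>\<in>space M. K \<omega> \<in> Q} = N.prob {x\<in>space N. K' x \<in> Q}" for Q
  proof -
    have [measurable]: "Measurable.pred M (\<lambda>\<omega>. K \<omega> \<in> Q)"
      by (rule measurable_compose[OF K]) simp
    \<comment> \<open>\<open>KU\<close> gives joint probabilities; as \<open>U \<le> 1\<close>
      almost surely, the level \<open>u = 1\<close> leaves the law of \<open>K\<close>
      alone.\<close>
    have "AE \<omega> in M. \<omega> \<in> {\<omega>\<in>space M. U \<omega> \<le> 1}"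
      using KU[of UNIV 1] N.prob_space by (intro AE_prob_1) simp
    then have "AE \<omega> in M. U \<omega> \<le> 1" by eventually_elim simp
    then have "prob {\<omega>\<in>space M. K \<omega> \<in> Q} = prob {\<omega>\<in>space M. K \<omega> \<in> Q \<and> U \<omega> \<le> 1}"
      by (intro finite_measure_eq_AE) auto
    then show ?thesis using KU[of Q 1] by simp
  qed
  \<comment> \<open>Zero-one valued everywhere: values of \<open>X i\<close> other than
    \<open>0\<close> and \<open>1\<close>, possible on a null set of \<open>N\<close>, are sent to
    \<open>0\<close>.\<close>
  define X' :: "nat \<Rightarrow> 'a \<Rightarrow> real" where "X' i \<omega> = of_bool (i \<in> K \<omega>)" for i \<omega>
  have X'_meas[measurable]: "X' i \<in> borel_measurable M" for i
    unfolding X'_def by (rule measurable_compose[OF K]) simp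
  have X': "X' i \<omega> = 1 \<longleftrightarrow> i \<in> K \<omega>" "X' i \<omega> = 0 \<longleftrightarrow> i \<notin> K \<omega>" for i \<omega>
    by (auto simp: X'_def)
  have "has_tail_dependence_matrix M d (mixture_vector p U U X') L"
  proof (rule mixture_tail_dependence[OF p U U X'_meas])
    fix i j u
    show "prob {\<omega>\<in>space M. X' i \<omega> = 1 \<and> X' j \<omega> = 1 \<and> U \<omega> \<le> u}
        = unit_cdf u * prob {\<omega>\<in>space M. X' i \<omega> = 1 \<and> X' j \<omega> = 1}"
      using KU[of "{S. i \<in> S \<and> j \<in> S}" u] K_distr[of "{S. i \<in> S \<and> j \<in> S}"] by (simp add: X' conj_assoc)
    show "prob {\<omega>\<in>space M. X' i \<omega> = 0 \<and> U \<omega> \<le> u}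
        = unit_cdf u * prob {\<omega>\<in>space M. X' i \<omega> = 0}"
      using KU[of "{S. i \<notin> S}" u] K_distr[of "{S. i \<notin> S}"] by (simp add: X')
  next
    fix i assume i: "i \<in> {1..d}"
    have "expectation (X' i) = prob {\<omega>\<in>space M. X' i \<omega> = 1}"
      by (rule expectation_zero_one[OF X'_meas]) (auto simp: X'_def)
    also have "\<dots> = N.prob {x\<in>space N. X i x = 1}"
      using K_distr[of "{S. i \<in> S}"] i by (simp add: X' K'_def)
    also have "\<dots> = p" using N.expectation_zero_one[OF X(1,2)[OF i]] X(3)[OF i] by simp
    finally show "expectation (X' i) = p" .
  next
    fix i j assume ij: "i \<in> {1..d}" "j \<in> {1..d}"
    have "expectation (\<lambda>\<omega>. X' i \<omega> * X' j \<omega>) = prob {\<omega>\<in>space M. X' i \<omega> = 1 \<and> X' j \<omega> = 1}"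
      by (rule expectation_zero_one_mult[OF X'_meas X'_meas]) (auto simp: X'_def)
    also have "\<dots> = N.prob {x\<in>space N. X i x = 1 \<and> X j x = 1}"
      using K_distr[of "{S. i \<in> S \<and> j \<in> S}"] ij by (simp add: X' K'_def)
    also have "\<dots> = L i j * p"
      using N.expectation_zero_one_mult[OF X(1)[OF ij(1)] X(1)[OF ij(2)] X(2)[OF ij(1)] X(2)[OF ij(2)]] L[OF ij] by simp
    finally show "expectation (\<lambda>\<omega>. X' i \<omega> * X' j \<omega>) = L i j * p" .
  qed (auto simp: X'_def)
  then show ?thesis unfolding is_tail_dependence_matrix_def by blast
qed


section \<open>Second moments of the three constructions\<close>

lemma (in prob_space) integrable_zero_one:
  assumes "X \<in> borel_measurable M" and "AE \<omega> in M. X \<omega> \<in> {0, 1::real}"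
  shows "integrable M X"
  using assms by (intro integrable_const_bound[where B = 1]) auto

text \<open>The mean \<open>\<alpha>\<close> plays the part of \<open>p\<close>. On the diagonal
  idempotence of \<open>X i\<close> gives \<open>\<alpha>\<close>, off it independence gives
  \<open>\<alpha> * \<alpha>\<close>.\<close>

lemma (in prob_space) equicorrelation_moment:
  assumes ind: "indep_vars (\<lambda>_. borel) X I" and ij: "i \<in> I" "j \<in> I"
    and X01: "\<And>k. k \<in> I \<Longrightarrow> AE \<omega> in M. X k \<omega> \<in> {0, 1}"
    and mean: "\<And>k. k \<in> I \<Longrightarrow> expectation (X k) = \<alpha>"
  shows "expectation (\<lambda>\<omega>. X i \<omega> * X j \<omega>) = equicorrelation_matrix \<alpha> i j * \<alpha>"
proof -
  have X: "X k \<in> borel_measurable M" if "k \<in> I" for k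
    using ind that by (auto simp: indep_vars_def)
  show ?thesis
  proof (cases "i = j")
    case True
    then show ?thesis
      using expectation_zero_one_mult[OF X X X01 X01, of i i] expectation_zero_one[OF X X01, of i] mean[of i] ij
      by (simp add: equicorrelation_matrix_def)
  next
    case False
    have "expectation (\<lambda>\<omega>. \<Prod>k\<in>{i, j}. X k \<omega>) = (\<Prod>k\<in>{i, j}. expectation (X k))"
      using ij X X01 by (intro indep_vars_lebesgue_integral indep_vars_subset[OF ind] integrable_zero_one) auto
    then show ?thesis using False ij mean by (simp add: equicorrelation_matrix_def)
  qed
qed

text \<open>Zero-one factors are idempotent, so those shared by \<open>A\<close> and
  \<open>B\<close> count once. Overlapping windows thus become a single product to which
  independence applies.\<close>

lemma zero_one_prod_Un:
  fixes z :: "'b \<Rightarrow> real"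
  assumes "finite A" "finite B" "\<And>k. k \<in> A \<union> B \<Longrightarrow> z k \<in> {0, 1}"
  shows "prod z A * prod z B = prod z (A \<union> B)"
proof (cases "\<exists>k\<in>A \<union> B. z k = 0")
  case True
  then have "prod z (A \<union> B) = 0" "prod z A = 0 \<or> prod z B = 0"
    using assms(1,2) by auto
  then show ?thesis by auto
next
  case False
  then have "z k = 1" if "k \<in> A \<union> B" for k using that assms(3) by blast
  then show ?thesis by simp
qed

lemma (in prob_space) expectation_prod_zero_one:
  assumes ind: "indep_vars (\<lambda>_. borel) Z I" and S: "S \<subseteq> I" "finite I"
    and Z01: "\<And>k. k \<in> I \<Longrightarrow> AE \<omega> in M. Z k \<omega> \<in> {0, 1::real}"
    and mean: "\<And>k. k \<in> I \<Longrightarrow> expectation (Z k) = \<alpha>"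
  shows "expectation (\<lambda>\<omega>. \<Prod>k\<in>S. Z k \<omega>) = \<alpha> ^ card S"
proof -
  have Z: "Z k \<in> borel_measurable M" if "k \<in> I" for k
    using ind that by (auto simp: indep_vars_def)
  have "expectation (\<lambda>\<omega>. \<Prod>k\<in>S. Z k \<omega>) = (\<Prod>k\<in>S. expectation (Z k))"
    using S Z Z01 by (intro indep_vars_lebesgue_integral indep_vars_subset[OF ind] integrable_zero_one)
      (auto intro: finite_subset)
  also have "\<dots> = \<alpha> ^ card S" using S mean by (simp add: subset_iff)
  finally show ?thesis .
qed

text \<open>Two windows of length \<open>d\<close> whose starting points differ by less than
  \<open>d\<close> leave no gap, so their union has \<open>d + |i - j|\<close> indices. The surplus
  over \<open>d\<close> is the exponent of the matrix entry, since
  \<open>p = \<alpha> ^ d\<close>.\<close>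

lemma (in prob_space) ar1_moment:
  assumes ind: "indep_vars (\<lambda>_. borel) Z {1..2 * d - 1}" and ij: "i \<in> {1..d}" "j \<in> {1..d}"
    and Z01: "\<And>k. k \<in> {1..2 * d - 1} \<Longrightarrow> AE \<omega> in M. Z k \<omega> \<in> {0, 1}"
    and mean: "\<And>k. k \<in> {1..2 * d - 1} \<Longrightarrow> expectation (Z k) = \<alpha>"
  shows "expectation (\<lambda>\<omega>. (\<Prod>k=i..i + d - 1. Z k \<omega>) * (\<Prod>k=j..j + d - 1. Z k \<omega>))
      = ar1_matrix \<alpha> i j * \<alpha> ^ d"
proof -
  let ?S = "\<lambda>i. {i..i + d - 1}"
  have sub: "?S i \<union> ?S j \<subseteq> {1..2 * d - 1}" using ij by auto
  have Z: "Z k \<in> borel_measurable M" if "k \<in> {1..2 * d - 1}" for k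
    using ind that by (auto simp: indep_vars_def)
  have "AE \<omega> in M. \<forall>k\<in>{1..2 * d - 1}. Z k \<omega> \<in> {0, 1}"
    using Z01 by (intro AE_finite_allI) auto
  then have "AE \<omega> in M. (\<Prod>k\<in>?S i. Z k \<omega>) * (\<Prod>k\<in>?S j. Z k \<omega>) = (\<Prod>k\<in>?S i \<union> ?S j. Z k \<omega>)"
  proof eventually_elim
    case (elim \<omega>)
    then show ?case using sub by (intro zero_one_prod_Un) blast+
  qed
  then have "expectation (\<lambda>\<omega>. (\<Prod>k\<in>?S i. Z k \<omega>) * (\<Prod>k\<in>?S j. Z k \<omega>))
    = expectation (\<lambda>\<omega>. \<Prod>k\<in>?S i \<union> ?S j. Z k \<omega>)"
    using sub Z by (intro integral_cong_AE borel_measurable_times borel_measurable_prod) auto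
  also have "\<dots> = \<alpha> ^ card (?S i \<union> ?S j)"
    using expectation_prod_zero_one[OF ind sub _ Z01 mean] by blast
  also have "card (?S i \<union> ?S j) = nat \<bar>int i - int j\<bar> + d"
  proof (cases "i \<le> j")
    case True
    then have "?S i \<union> ?S j = {i..j + d - 1}" using ij by auto
    then show ?thesis using True ij by simp
  next
    case False
    then have "?S i \<union> ?S j = {j..i + d - 1}" using ij by auto
    then show ?thesis using False ij by simp
  qed
  finally show ?thesis by (simp add: ar1_matrix_def power_add)
qed

text \<open>The moment is the overlap of two unit intervals divided by \<open>d\<close>.
  Neighbouring intervals overlap in length \<open>\<alpha>\<close>; for indices further apart the
  left endpoints differ by at least \<open>2 * (1 - \<alpha>)\<close>, which is at least
  \<open>1\<close> because \<open>\<alpha> \<le> 1 / 2\<close>, so the overlap is null.\<close>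

lemma (in prob_space) ma1_moments:
  fixes \<alpha> :: real
  assumes Z: "uniform_rv M Z 0 (real d)" and \<alpha>: "0 \<le> \<alpha>" "\<alpha> \<le> 1 / 2" and ij: "i \<in> {1..d}" "j \<in> {1..d}"
    and X: "\<And>i \<omega>. i \<in> {1..d} \<Longrightarrow> \<omega> \<in> space M \<Longrightarrow>
      X i \<omega> = indicator {(real i - 1) * (1 - \<alpha>) .. (real i - 1) * (1 - \<alpha>) + 1} (Z \<omega>)"
  shows "expectation (\<lambda>\<omega>. X i \<omega> * X j \<omega>) = ma1_matrix \<alpha> i j * (1 / d)"
    and "expectation (X i) = 1 / d"
proof -
  have [measurable]: "Z \<in> borel_measurable M" using Z by (simp add: uniform_rv_def)
  define a where "a k = (real k - 1) * (1 - \<alpha>)" for k :: nat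
  \<comment> \<open>The unit intervals stay inside \<open>[0, d]\<close>, so intersecting with the
    range of \<open>Z\<close> loses no length.\<close>
  have a: "0 \<le> a k" "a k + 1 \<le> d" if "k \<in> {1..d}" for k
  proof -
    show "0 \<le> a k" using that \<alpha> by (simp add: a_def)
    have "a k \<le> (real k - 1) * 1" unfolding a_def using that \<alpha> by (intro mult_left_mono) auto
    then show "a k + 1 \<le> d" using that by simp
  qed
  have *: "expectation (\<lambda>\<omega>. X i \<omega> * X j \<omega>) = max 0 (1 - \<bar>a i - a j\<bar>) / d"
    if ij: "i \<in> {1..d}" "j \<in> {1..d}" for i j
  proof -
    \<comment> \<open>The intersection of the two unit intervals, empty if the left endpoints differ
      by more than \<open>1\<close>; hence the \<open>max 0\<close> in its length.\<close>
    let ?I = "{max (a i) (a j)..min (a i) (a j) + 1}"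
    have "expectation (\<lambda>\<omega>. X i \<omega> * X j \<omega>) = expectation (indicator {\<omega>\<in>space M. Z \<omega> \<in> ?I})"
      using ij by (intro Bochner_Integration.integral_cong) (auto simp: X a_def[symmetric] indicator_def)
    also have "\<dots> = prob {\<omega>\<in>space M. Z \<omega> \<in> ?I}" by simp
    also have "\<dots> = measure lborel ({0..real d} \<inter> ?I) / (real d - 0)"
      using ij by (intro uniform_rv_prob[OF Z]) auto
    also have "{0..real d} \<inter> ?I = ?I" using a[OF ij(1)] a[OF ij(2)] by auto
    also have "measure lborel ?I = max 0 (1 - \<bar>a i - a j\<bar>)"
      by (cases "a i \<le> a j") (auto simp: measure_def emeasure_lborel_Icc_eq)
    finally show ?thesis by simp
  qed
  have "\<bar>a i - a j\<bar> = \<bar>real i - real j\<bar> * (1 - \<alpha>)"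
  proof -
    have "a i - a j = (real i - real j) * (1 - \<alpha>)" by (simp add: a_def algebra_simps)
    then show ?thesis using \<alpha> by (simp add: abs_mult)
  qed
  moreover have "max 0 (1 - \<bar>real i - real j\<bar> * (1 - \<alpha>)) = ma1_matrix \<alpha> i j"
  proof -
    consider "i = j" | "\<bar>int i - int j\<bar> = 1" | "2 \<le> \<bar>int i - int j\<bar>" by linarith
    then show ?thesis
    proof cases
      case 2
      then have "\<bar>real i - real j\<bar> = 1" by linarith
      then show ?thesis using 2 \<alpha> by (auto simp: ma1_matrix_def)
    next
      case 3
      then have "2 \<le> \<bar>real i - real j\<bar>" by linarith
      then have "2 * (1 - \<alpha>) \<le> \<bar>real i - real j\<bar> * (1 - \<alpha>)" using \<alpha> by (intro mult_right_mono) auto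
      then show ?thesis using 3 \<alpha> by (auto simp: ma1_matrix_def)
    qed (simp add: ma1_matrix_def)
  qed
  ultimately show "expectation (\<lambda>\<omega>. X i \<omega> * X j \<omega>) = ma1_matrix \<alpha> i j * (1 / d)"
    using *[OF ij] by simp
  \<comment> \<open>Zero-one values make the mean a diagonal second moment.\<close>
  have "expectation (X i) = expectation (\<lambda>\<omega>. X i \<omega> * X i \<omega>)"
    using ij by (intro Bochner_Integration.integral_cong) (auto simp: X indicator_def)
  then show "expectation (X i) = 1 / d" using *[OF ij(1) ij(1)] by simp
qed

section \<open>Model spaces and realisation of the three matrices\<close>

lemma bernoulli_rv_zero_one:
  assumes "bernoulli_rv M Z \<alpha>"
  shows "AE \<omega> in M. Z \<omega> \<in> {0, 1}"
proof -
  have Z: "Z \<in> borel_measurable M" "distr M borel Z = distr (measure_pmf (bernoulli_pmf \<alpha>)) borel of_bool"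
    using assms by (auto simp: bernoulli_rv_def)
  have "AE x in distr M borel Z. x \<in> {0, 1::real}"
    unfolding Z(2) by (subst AE_distr_iff) auto
  then show ?thesis using Z(1) by (subst (asm) AE_distr_iff) auto
qed

lemma bernoulli_rv_expectation:
  assumes "bernoulli_rv M Z \<alpha>" "0 \<le> \<alpha>" "\<alpha> \<le> 1"
  shows "integral\<^sup>L M Z = \<alpha>"
proof -
  have Z: "Z \<in> borel_measurable M" "distr M borel Z = distr (measure_pmf (bernoulli_pmf \<alpha>)) borel of_bool"
    using assms by (auto simp: bernoulli_rv_def)
  have "integral\<^sup>L M Z = integral\<^sup>L (distr M borel Z) (\<lambda>x. x)"
    using Z(1) by (simp add: integral_distr)
  also have "\<dots> = measure_pmf.expectation (bernoulli_pmf \<alpha>) of_bool"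
    unfolding Z(2) by (simp add: integral_distr)
  also have "\<dots> = \<alpha>" using assms by simp
  finally show ?thesis .
qed

text \<open>The coordinates of a product of Bernoulli laws serve; \<open>False\<close> is the
  default value of \<open>Pi_pmf\<close> off \<open>I\<close>.\<close>

lemma indep_bernoulli_exists:
  assumes "finite I" "0 \<le> \<alpha>" "\<alpha> \<le> 1"
  obtains N :: "('i \<Rightarrow> bool) measure" and Z :: "'i \<Rightarrow> ('i \<Rightarrow> bool) \<Rightarrow> real"
  where "prob_space N" "prob_space.indep_vars N (\<lambda>_. borel) Z I" "\<And>i f. Z i f \<in> {0, 1}"
    "\<And>i. i \<in> I \<Longrightarrow> integral\<^sup>L N (Z i) = \<alpha>"
proof
  let ?P = "Pi_pmf I False (\<lambda>_. bernoulli_pmf \<alpha>)"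
  show "prob_space ?P" by (rule measure_pmf.prob_space_axioms)
  show "prob_space.indep_vars ?P (\<lambda>_. borel) (\<lambda>i f. of_bool (f i)) I"
    by (rule prob_space.indep_vars_compose2[OF measure_pmf.prob_space_axioms indep_vars_Pi_pmf[OF assms(1)]]) simp
  fix i assume "i \<in> I"
  have "measure_pmf.expectation ?P (\<lambda>f. of_bool (f i) :: real)
    = measure_pmf.expectation (map_pmf (\<lambda>f. f i) ?P) of_bool"
    unfolding map_pmf_rep_eq by (subst integral_distr) simp_all
  also have "\<dots> = \<alpha>" using assms \<open>i \<in> I\<close> by (simp add: Pi_pmf_component)
  finally show "measure_pmf.expectation ?P (\<lambda>f. of_bool (f i)) = \<alpha>" .
qed auto

text \<open>The model is normalised Lebesgue measure on \<open>[0, d]\<close> with the identity as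
  \<open>Z\<close>. Its mean \<open>1 / d\<close> is positive even for \<open>\<alpha> = 0\<close>,
  so it also realises the identity matrix for the other two families.\<close>

lemma (in prob_space) is_tail_dependence_matrix_ma1:
  assumes "atomless M" "1 \<le> d" "0 \<le> \<alpha>" "\<alpha> \<le> 1 / 2"
  shows "is_tail_dependence_matrix M d (ma1_matrix \<alpha>)"
proof -
  define N where "N = uniform_measure lborel {0..real d}"
  interpret N: prob_space N
    unfolding N_def using assms(2) by (intro prob_space_uniform_measure) auto
  define X where "X i z = (indicator {(real i - 1) * (1 - \<alpha>) .. (real i - 1) * (1 - \<alpha>) + 1} z :: real)"
    for i :: nat and z
  have "uniform_rv N (\<lambda>z. z) 0 (real d)"
    unfolding uniform_rv_def N_def by (auto intro!: distr_id2)
  note moments = N.ma1_moments[OF this assms(3,4), where X = X]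
  show ?thesis
  proof (rule atomless_is_tail_dependence_matrix[OF assms(1) N.prob_space_axioms])
    show "N.expectation (X i) = 1 / d" if "i \<in> {1..d}" for i
      using that by (intro moments(2)[of i i]) (auto simp: X_def)
    show "N.expectation (\<lambda>z. X i z * X j z) = ma1_matrix \<alpha> i j * (1 / d)"
      if "i \<in> {1..d}" "j \<in> {1..d}" for i j
      using that by (intro moments(1)) (auto simp: X_def)
    show "X i \<in> borel_measurable N" for i unfolding X_def N_def by simp
  qed (use assms in \<open>auto simp: X_def indicator_def\<close>)
qed

lemma (in prob_space) is_tail_dependence_matrix_equicorrelation:
  assumes "atomless M" "1 \<le> d" "0 \<le> \<alpha>" "\<alpha> \<le> 1"
  shows "is_tail_dependence_matrix M d (equicorrelation_matrix \<alpha>)"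
proof (cases "\<alpha> = 0")
  case True
  have "equicorrelation_matrix 0 = ma1_matrix 0"
    by (intro ext) (simp add: equicorrelation_matrix_def ma1_matrix_def)
  then show ?thesis using is_tail_dependence_matrix_ma1[OF assms(1,2), of 0] True by simp
next
  case False
  obtain N :: "(nat \<Rightarrow> bool) measure" and X
    where N: "prob_space N" and X: "prob_space.indep_vars N (\<lambda>_. borel) X {1..d}"
      "\<And>i f. X i f \<in> {0, 1}" "\<And>i. i \<in> {1..d} \<Longrightarrow> integral\<^sup>L N (X i) = \<alpha>"
    using indep_bernoulli_exists[OF finite_atLeastAtMost assms(3,4)] by metis
  interpret N: prob_space N by fact
  show ?thesis
  proof (rule atomless_is_tail_dependence_matrix[OF assms(1) N])
    show "N.expectation (\<lambda>z. X i z * X j z) = equicorrelation_matrix \<alpha> i j * \<alpha>"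
      if "i \<in> {1..d}" "j \<in> {1..d}" for i j
      using X that by (intro N.equicorrelation_moment) auto
    show "X i \<in> borel_measurable N" if "i \<in> {1..d}" for i
      using X(1) that by (auto simp: N.indep_vars_def)
  qed (use X assms False in auto)
qed

lemma (in prob_space) is_tail_dependence_matrix_ar1:
  assumes "atomless M" "1 \<le> d" "0 \<le> \<alpha>" "\<alpha> \<le> 1"
  shows "is_tail_dependence_matrix M d (ar1_matrix \<alpha>)"
proof (cases "\<alpha> = 0")
  case True
  \<comment> \<open>With \<open>0 ^ 0 = 1\<close> both sides are the identity matrix, realised with
    mean \<open>1 / d\<close> in place of the vanishing \<open>\<alpha> ^ d\<close>.\<close>
  have "ar1_matrix 0 = ma1_matrix 0"
    by (intro ext) (simp add: ar1_matrix_def ma1_matrix_def power_0_left)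
  then show ?thesis using is_tail_dependence_matrix_ma1[OF assms(1,2), of 0] True by simp
next
  case False
  obtain N :: "(nat \<Rightarrow> bool) measure" and Z
    where N: "prob_space N" and Z: "prob_space.indep_vars N (\<lambda>_. borel) Z {1..2 * d - 1}"
      "\<And>i f. Z i f \<in> {0, 1}" "\<And>i. i \<in> {1..2 * d - 1} \<Longrightarrow> integral\<^sup>L N (Z i) = \<alpha>"
    using indep_bernoulli_exists[OF finite_atLeastAtMost assms(3,4)] by metis
  interpret N: prob_space N by fact
  define X where "X i f = (\<Prod>k=i..i + d - 1. Z k f)" for i f
  have sub: "{i..i + d - 1} \<subseteq> {1..2 * d - 1}" if "i \<in> {1..d}" for i using that by auto
  show ?thesis
  proof (rule atomless_is_tail_dependence_matrix[OF assms(1) N])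
    show "N.expectation (\<lambda>z. X i z * X j z) = ar1_matrix \<alpha> i j * \<alpha> ^ d"
      if "i \<in> {1..d}" "j \<in> {1..d}" for i j
      unfolding X_def using Z that by (intro N.ar1_moment) auto
    show "N.expectation (X i) = \<alpha> ^ d" if "i \<in> {1..d}" for i
      using N.expectation_prod_zero_one[OF Z(1) sub[OF that] _ _ Z(3)] Z(2) assms(2)
      by (simp add: X_def[abs_def])
    show "X i \<in> borel_measurable N" if "i \<in> {1..d}" for i
      unfolding X_def using Z(1) sub[OF that]
      by (intro borel_measurable_prod) (auto simp: N.indep_vars_def)
    have "X i f \<in> {0, 1}" for i f
    proof (cases "\<exists>k\<in>{i..i + d - 1}. Z k f = 0")
      case True
      then show ?thesis unfolding X_def by (simp add: prod_zero_iff)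
    next
      case False
      then have "Z k f = 1" if "k \<in> {i..i + d - 1}" for k using that Z(2)[of k f] by blast
      then show ?thesis by (simp add: X_def)
    qed
    then show "AE f in N. X i f \<in> {0, 1}" for i by simp
  qed (use assms False in \<open>auto intro: power_le_one\<close>)
qed

theorem proposition4p1:
  fixes M :: "'a measure" and d :: nat
  assumes "prob_space M" and "atomless M" and "1 \<le> d"
  shows
    "(\<forall>\<alpha>::real. 0 \<le> \<alpha> \<and> \<alpha> \<le> 1 \<longrightarrow>
        (\<forall>p U V X.
          mixture_setting M d p U V X \<and>
          prob_space.indep_vars M (\<lambda>_. borel) X {1..d} \<and>
          (\<forall>i\<in>{1..d}. integral\<^sup>L M (X i) = \<alpha>) \<longrightarrow>
          has_tail_dependence_matrix M d (mixture_vector p U V X) (equicorrelation_matrix \<alpha>)) \<and>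
        is_tail_dependence_matrix M d (equicorrelation_matrix \<alpha>)) \<and>
     (\<forall>\<alpha>::real. 0 \<le> \<alpha> \<and> \<alpha> \<le> 1 \<longrightarrow>
        (\<forall>p U V X Z.
          mixture_setting M d p U V X \<and>
          prob_space.indep_vars M (\<lambda>_. borel) Z {1..2 * d - 1} \<and>
          (\<forall>j\<in>{1..2 * d - 1}. bernoulli_rv M (Z j) \<alpha>) \<and>
          (\<forall>i\<in>{1..d}. \<forall>\<omega>\<in>space M. X i \<omega> = (\<Prod>j=i..i + d - 1. Z j \<omega>)) \<longrightarrow>
          has_tail_dependence_matrix M d (mixture_vector p U V X) (ar1_matrix \<alpha>)) \<and>
        is_tail_dependence_matrix M d (ar1_matrix \<alpha>)) \<and>
     (\<forall>\<alpha>::real. 0 \<le> \<alpha> \<and> \<alpha> \<le> 1 / 2 \<longrightarrow>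
        (\<forall>p U V X Z.
          mixture_setting M d p U V X \<and>
          uniform_rv M Z 0 (real d) \<and>
          (\<forall>i\<in>{1..d}. \<forall>\<omega>\<in>space M.
             X i \<omega> = indicator {(real i - 1) * (1 - \<alpha>) .. (real i - 1) * (1 - \<alpha>) + 1} (Z \<omega>)) \<longrightarrow>
          has_tail_dependence_matrix M d (mixture_vector p U V X) (ma1_matrix \<alpha>)) \<and>
        is_tail_dependence_matrix M d (ma1_matrix \<alpha>))"
proof (intro conjI allI impI; (elim conjE)?)
  interpret prob_space M by fact
  have d: "1 \<in> {1..d}" using assms(3) by simp
  {
    fix \<alpha> p :: real and U V and X :: "nat \<Rightarrow> 'a \<Rightarrow> real"
    assume \<alpha>: "0 \<le> \<alpha>" "\<alpha> \<le> 1" and mix: "mixture_setting M d p U V X"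
      and X: "indep_vars (\<lambda>_. borel) X {1..d}" "\<forall>i\<in>{1..d}. expectation (X i) = \<alpha>"
    \<comment> \<open>\<open>p\<close> is the common mean of the components, and
      \<open>1 \<le> d\<close> supplies a component to read it off. With \<open>0 < p\<close> this
      confines the mixture claim to \<open>\<alpha> > 0\<close>.\<close>
    have p: "p = \<alpha>" using mix X(2) d unfolding mixture_setting_def by metis
    show "has_tail_dependence_matrix M d (mixture_vector p U V X) (equicorrelation_matrix \<alpha>)"
      unfolding p
      using mix X by (intro mixture_setting_tail_dependence[OF mix[unfolded p]] equicorrelation_moment[OF X(1)])
        (auto simp: mixture_setting_def)
  }
  {
    fix \<alpha> p :: real and U V and X Z :: "nat \<Rightarrow> 'a \<Rightarrow> real"
    assume \<alpha>: "0 \<le> \<alpha>" "\<alpha> \<le> 1" and mix: "mixture_setting M d p U V X"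
      and ind: "indep_vars (\<lambda>_. borel) Z {1..2 * d - 1}"
      and Z: "\<forall>j\<in>{1..2 * d - 1}. bernoulli_rv M (Z j) \<alpha>"
      and X: "\<forall>i\<in>{1..d}. \<forall>\<omega>\<in>space M. X i \<omega> = (\<Prod>j=i..i + d - 1. Z j \<omega>)"
    have Z01: "AE \<omega> in M. Z k \<omega> \<in> {0, 1}" "expectation (Z k) = \<alpha>" if "k \<in> {1..2 * d - 1}" for k
      using bernoulli_rv_zero_one bernoulli_rv_expectation Z \<alpha> that by blast+
    \<comment> \<open>The mean is computed at the first window, whose \<open>d\<close> independent
      factors give \<open>\<alpha> ^ d\<close>.\<close>
    have "p = expectation (X 1)" using mix d unfolding mixture_setting_def by metis
    also have "\<dots> = expectation (\<lambda>\<omega>. \<Prod>k=1..1 + d - 1. Z k \<omega>)"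
      using X d by (intro Bochner_Integration.integral_cong) auto
    also have "\<dots> = \<alpha> ^ d"
      using expectation_prod_zero_one[OF ind, of "{1..1 + d - 1}" \<alpha>] Z01 assms(3) by simp
    finally have p: "p = \<alpha> ^ d" .
    show "has_tail_dependence_matrix M d (mixture_vector p U V X) (ar1_matrix \<alpha>)"
    proof (rule mixture_setting_tail_dependence[OF mix])
      fix i j assume ij: "i \<in> {1..d}" "j \<in> {1..d}"
      have "expectation (\<lambda>\<omega>. X i \<omega> * X j \<omega>)
        = expectation (\<lambda>\<omega>. (\<Prod>k=i..i + d - 1. Z k \<omega>) * (\<Prod>k=j..j + d - 1. Z k \<omega>))"
        using X ij by (intro Bochner_Integration.integral_cong) auto
      then show "expectation (\<lambda>\<omega>. X i \<omega> * X j \<omega>) = ar1_matrix \<alpha> i j * p"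
        using ar1_moment[OF ind ij Z01] p by simp
    qed
  }
  {
    fix \<alpha> p :: real and U V Z and X :: "nat \<Rightarrow> 'a \<Rightarrow> real"
    assume \<alpha>: "0 \<le> \<alpha>" "\<alpha> \<le> 1 / 2" and mix: "mixture_setting M d p U V X"
      and Z: "uniform_rv M Z 0 (real d)"
      and X: "\<forall>i\<in>{1..d}. \<forall>\<omega>\<in>space M.
        X i \<omega> = indicator {(real i - 1) * (1 - \<alpha>) .. (real i - 1) * (1 - \<alpha>) + 1} (Z \<omega>)"
    note moments = ma1_moments[OF Z \<alpha>, of _ _ X]
    have "p = expectation (X 1)" using mix d unfolding mixture_setting_def by metis
    also have "\<dots> = 1 / d" using X d by (intro moments(2)[of 1 1]) auto
    finally have p: "p = 1 / d" .
    show "has_tail_dependence_matrix M d (mixture_vector p U V X) (ma1_matrix \<alpha>)"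
      using X unfolding p by (intro mixture_setting_tail_dependence[OF mix[unfolded p]] moments(1)) auto
  }
qed (use assms prob_space.is_tail_dependence_matrix_equicorrelation
      prob_space.is_tail_dependence_matrix_ar1 prob_space.is_tail_dependence_matrix_ma1 in blast)+

end
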